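(* Let $m\ge1$ and let $\mathscr{M}$ be a collection of $m\times m$ doubly stochastic matrices. Then $\mathscr{M}$ is absolutely asymptotically stable if and only if its zero-flow graph $G_0(\mathscr{M})$ is cycle-free.
   Context: $[m]=\{1,\dots,m\}$; $S\subset[m]$ denotes a proper subset, and $\bar S=[m]\setminus S$. A matrix is stochastic if its entries are nonnegative and each row sums to $1$; it is doubly stochastic if both it and its transpose are stochastic. A vector is stochastic if its entries are nonnegative and sum to $1$; $e$ is the all-ones column vector. For $k>s\ge 0$, $A(k:s)=A(k-1)A(k-2)\cdots A(s)$. A sequence $\{A(k)\}_{k\ge0}$ of stochastic matrices (a chain) is ergodic if for every $s\ge0$ there is a stochastic vector $v(s)$ with $\lim_{k\to\infty}A(k:s)=e\,v(s)^T$. A chain $\{A(k)\}$ is in $\mathscr{M}$ if $A(k)\in\mathscr{M}$ for all $k\ge0$. A collection $\mathscr{M}$ of stochastic matrices is absolutely asymptotically stable if every chain in $\mathscr{M}$ is ergodic. For $S,T\subset[m]$ and a matrix $A$, $A_{TS}=\sum_{i\in T,\,j\in\bar S}A_{ij}+\sum_{i\in\bar T,\,j\in S}A_{ij}$. The zero-flow graph $G_0(\mathscr{M})$ is the directed graph whose vertex set is the set of all subsets of $[m]$ and whose edge set is $$\mathcal E_0(\mathscr{M})=\{(S,T)\mid S,T\subset[m],\ |S|=|T|\ne0,\ \inf_{A\in\mathscr{M}}A_{TS}=0\}.$$ A cycle in a directed graph is a sequence $u_0\to u_1\to\cdots\to u_{r-1}\to u_r=u_0$, $r\ge1$, of edges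 with $u_0,\dots,u_{r-1}$ distinct; a loop $(v,v)$ is a cycle. A directed graph is cycle-free if it contains no cycle. *)

theory Defs
  imports
    "HOL-Analysis.Analysis"
    "Graph_Theory.Pair_Digraph"
begin

text \<open>
  The index set \<open>[m]\<close> is rendered as a finite type \<open>'n\<close> with \<open>m = CARD('n)\<close>, so complements of
  index sets are plain set complements and \<open>S\<close> is a proper subset iff \<open>S \<noteq> UNIV\<close>.
\<close>

definition stochastic_vector :: "real^'n \<Rightarrow> bool" where
  "stochastic_vector v \<longleftrightarrow> (\<forall>i. 0 \<le> v $ i) \<and> (\<Sum>i\<in>UNIV. v $ i) = 1"

definition stochastic :: "real^'n^'n \<Rightarrow> bool" where
  "stochastic A \<longleftrightarrow> (\<forall>i j. 0 \<le> A $ i $ j) \<and> (\<forall>i. (\<Sum>j\<in>UNIV. A $ i $ j) = 1)"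

definition doubly_stochastic :: "real^'n^'n \<Rightarrow> bool" where
  "doubly_stochastic A \<longleftrightarrow> stochastic A \<and> stochastic (transpose A)"

text \<open>
  \<open>chain_prod A k s\<close> is \<open>A(k:s) = A(k-1) A(k-2) \<cdots> A(s)\<close> for \<open>k > s\<close>. For \<open>k \<le> s\<close> it is the
  identity matrix, a value that does not affect limits as \<open>k\<close> tends to infinity.
\<close>

primrec chain_prod :: "(nat \<Rightarrow> real^'n^'n) \<Rightarrow> nat \<Rightarrow> nat \<Rightarrow> real^'n^'n" where
  "chain_prod A 0 s = mat 1"
| "chain_prod A (Suc k) s = (if s \<le> k then A k ** chain_prod A k s else mat 1)"

text \<open>In the next definition, \<open>\<chi> i j. v $ j\<close> is \<open>e v\<^sup>T\<close>, the matrix all of whose rows equal \<open>v\<close>.\<close>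

definition ergodic :: "(nat \<Rightarrow> real^'n^'n) \<Rightarrow> bool" where
  "ergodic A \<longleftrightarrow> (\<forall>k. stochastic (A k)) \<and>
     (\<forall>s. \<exists>v. stochastic_vector v \<and> (\<lambda>k. chain_prod A k s) \<longlonglongrightarrow> (\<chi> i j. v $ j))"

definition absolutely_asymptotically_stable :: "(real^'n^'n) set \<Rightarrow> bool" where
  "absolutely_asymptotically_stable M \<longleftrightarrow> (\<forall>A. (\<forall>k. A k \<in> M) \<longrightarrow> ergodic A)"

definition flow :: "real^'n^'n \<Rightarrow> 'n set \<Rightarrow> 'n set \<Rightarrow> real" where
  "flow A T S = (\<Sum>i\<in>T. \<Sum>j\<in>-S. A $ i $ j) + (\<Sum>i\<in>-T. \<Sum>j\<in>S. A $ i $ j)"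

text \<open>
  The infimum is taken in the extended reals, so that over the empty collection it is \<open>\<infinity>\<close>
  (and the graph then has no edges) instead of an unspecified real number.
\<close>

definition zero_flow_graph :: "(real^'n^'n) set \<Rightarrow> 'n set pair_pre_digraph" where
  "zero_flow_graph M =
     \<lparr> pverts = UNIV,
       parcs = {(S, T). S \<noteq> UNIV \<and> T \<noteq> UNIV \<and> card S = card T \<and> card T \<noteq> 0 \<and>
                  (INF A\<in>M. ereal (flow A T S)) = 0} \<rparr>"

text \<open>\<^const>\<open>pre_digraph.cycle\<close> counts loops as cycles.\<close>

definition cycle_free :: "('a, 'b) pre_digraph \<Rightarrow> bool" where
  "cycle_free G \<longleftrightarrow> \<not> (\<exists>p. pre_digraph.cycle G p)"

end

theory Submission
  imports Defs
begin

text \<open>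
  For a doubly stochastic matrix \<open>A\<close>, the flow \<open>A\<^bsub>TS\<^esub>\<close> is the \<open>\<ell>\<^sup>1\<close> distance between
  \<open>A 1\<^sub>S\<close> and \<open>1\<^sub>T\<close>. An edge \<open>S \<rightarrow> T\<close> therefore says that matrices of the collection move the
  indicator of \<open>S\<close> arbitrarily close to the indicator of \<open>T\<close>. As there are finitely many
  vertices, the graph has a cycle iff it carries an infinite walk, and both directions of the
  equivalence are proved for infinite walks.

  Given an infinite walk \<open>S\<^sub>0 \<rightarrow> S\<^sub>1 \<rightarrow> \<cdots>\<close>, choose the matrices of a chain so that the \<open>k\<close>-th flow is
  at most \<open>2\<^bsup>-k-3\<^esup>\<close>. Doubly stochastic matrices do not increase the \<open>\<ell>\<^sup>1\<close> norm, so the errors only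
  add up, and \<open>A(k:0)\<close> applied to the indicator of \<open>S\<^sub>0\<close> stays within \<open>1/4\<close> of the indicator of \<open>S\<^sub>k\<close>
  (\<open>chain_tracks_walk\<close>). Since \<open>S\<^sub>k\<close> is neither empty nor full, these vectors cannot
  approach a constant vector, and the chain is not ergodic.

  Conversely, follow a vector \<open>x(k+1) = A(k) x(k)\<close>. Let \<open>f\<^sub>p(x)\<close> be the sum of the \<open>p\<close> largest entries
  of \<open>x\<close>. The second difference \<open>2 f\<^sub>p - f\<^bsub>p-1\<^esub> - f\<^bsub>p+1\<^esub>\<close> is the gap between the \<open>p\<close>-th and the
  \<open>(p+1)\<close>-th largest entry, and one step lowers \<open>f\<^sub>p\<close> by at least this gap times half the flow
  between the sets of the \<open>p\<close> largest positions before and after it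
  (\<open>largest_sum_decrease\<close>). Each \<open>f\<^sub>p(x(k))\<close> is thus decreasing, and it converges. If the limit
  of some gap were positive, the flows between successive top sets would tend to zero; then every
  transition of top sets that occurs infinitely often would be an edge, so a tail of the top sets
  would be an infinite walk (\<open>limit_gap_zero\<close>). Hence without infinite walks all gaps vanish in
  the limit, the entries of \<open>x(k)\<close> come together, and they tend to their average, which every
  \<open>A(k)\<close> preserves (\<open>tends_to_average\<close>). Applied to unit vectors this gives \<open>A(k:s) \<rightarrow> e e\<^sup>T / m\<close>.
\<close>

section \<open>Cycles and infinite walks\<close>

text \<open>
  On finitely many vertices, acyclicity of the edge relation is well-foundedness of its converse.
\<close>

lemma cycle_free_iff_no_infinite_walk:
  fixes G :: "('a :: finite) pair_pre_digraph"
  assumes "pverts G = UNIV"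
  shows "cycle_free (with_proj G) \<longleftrightarrow> \<not> (\<exists>S. \<forall>k. (S k, S (Suc k)) \<in> parcs G)"
proof -
  interpret wf_digraph "with_proj G"
    by unfold_locales (auto simp: assms)
  have "(\<exists>p. cycle p) \<longleftrightarrow> (\<exists>u p. awalk u p u \<and> p \<noteq> [])"
    using closed_w_imp_cycle unfolding closed_w_def cycle_def by fastforce
  also have "\<dots> \<longleftrightarrow> (\<exists>u. (u, u) \<in> (parcs G)\<^sup>+)"
    using reachable1_awalk by (auto simp: arcs_ends_def arc_to_ends_def)
  finally have "cycle_free (with_proj G) \<longleftrightarrow> acyclic (parcs G)"
    by (auto simp: cycle_free_def acyclic_def)
  also have "\<dots> \<longleftrightarrow> wf ((parcs G)\<inverse>)"
    by (metis acyclic_converse finite finite_acyclic_wf_converse wf_acyclic)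
  also have "\<dots> \<longleftrightarrow> \<not> (\<exists>S. \<forall>k. (S k, S (Suc k)) \<in> parcs G)"
    by (simp add: wf_iff_no_infinite_down_chain)
  finally show ?thesis .
qed

section \<open>Doubly stochastic matrices and flows\<close>

lemma doubly_stochastic_nonneg: "doubly_stochastic A \<Longrightarrow> 0 \<le> A $ i $ j"
  and doubly_stochastic_row: "doubly_stochastic A \<Longrightarrow> (\<Sum>j\<in>UNIV. A $ i $ j) = 1"
  and doubly_stochastic_column: "doubly_stochastic A \<Longrightarrow> (\<Sum>i\<in>UNIV. A $ i $ j) = 1"
  by (simp_all add: doubly_stochastic_def stochastic_def transpose_def)

lemma doubly_stochastic_sum_preserved:
  assumes "doubly_stochastic A"
  shows "(\<Sum>i\<in>UNIV. (A *v x) $ i) = (\<Sum>i\<in>UNIV. x $ i)"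
proof -
  have "(\<Sum>i\<in>UNIV. (A *v x) $ i) = (\<Sum>j\<in>UNIV. (\<Sum>i\<in>UNIV. A $ i $ j) * x $ j)"
    by (simp add: matrix_vector_mult_def sum_distrib_right) (rule sum.swap)
  then show ?thesis
    by (simp add: doubly_stochastic_column[OF assms])
qed

text \<open>
  Taking absolute values inside only increases the left-hand side, and on \<open>\<bar>x\<bar>\<close> the matrix preserves
  the sum because its columns sum to one.
\<close>

lemma doubly_stochastic_l1_nonexpansive:
  assumes "doubly_stochastic A"
  shows "(\<Sum>i\<in>UNIV. \<bar>(A *v x) $ i\<bar>) \<le> (\<Sum>i\<in>UNIV. \<bar>x $ i\<bar>)"
proof -
  have "(\<Sum>i\<in>UNIV. \<bar>(A *v x) $ i\<bar>) \<le> (\<Sum>i\<in>UNIV. (A *v (\<chi> j. \<bar>x $ j\<bar>)) $ i)"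
    using doubly_stochastic_nonneg[OF assms]
    by (intro sum_mono)
       (auto simp: matrix_vector_mult_def abs_mult intro!: order_trans[OF sum_abs] sum_mono)
  then show ?thesis
    by (simp add: doubly_stochastic_sum_preserved[OF assms])
qed

lemma flow_nonneg: "doubly_stochastic A \<Longrightarrow> 0 \<le> flow A T S"
  by (simp add: flow_def sum_nonneg doubly_stochastic_nonneg)

text \<open>
  The \<open>i\<close>-th entry of \<open>A 1\<^sub>S\<close> is the mass that row \<open>i\<close> places on \<open>S\<close>. For \<open>i \<in> T\<close> its distance to one is
  the mass placed on \<open>-S\<close>; for \<open>i \<notin> T\<close> its distance to zero is the mass itself.
\<close>

lemma flow_eq_l1_distance:
  fixes A :: "real^'n^'n"
  assumes "doubly_stochastic A"
  shows "flow A T S =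
    (\<Sum>i\<in>UNIV. \<bar>(A *v (\<chi> j. indicator S j)) $ i - indicator T i\<bar>)"
proof -
  have ind: "(A *v (\<chi> j. indicator S j)) $ i = (\<Sum>j\<in>S. A $ i $ j)" for i
    by (simp add: matrix_vector_mult_def indicator_def if_distrib[of "(*) _"] sum.If_cases
        cong: if_cong)
  have row: "(\<Sum>j\<in>S. A $ i $ j) + (\<Sum>j\<in>-S. A $ i $ j) = 1" for i
    using doubly_stochastic_row[OF assms, of i] sum.union_disjoint[of S "-S" "\<lambda>j. A $ i $ j"]
    by simp
  have nonneg: "0 \<le> (\<Sum>j\<in>R. A $ i $ j)" for R i
    by (simp add: sum_nonneg doubly_stochastic_nonneg[OF assms])
  have "(\<Sum>i\<in>UNIV. \<bar>(A *v (\<chi> j. indicator S j)) $ i - indicator T i\<bar>)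
      = (\<Sum>i\<in>T. \<bar>(\<Sum>j\<in>S. A $ i $ j) - 1\<bar>) + (\<Sum>i\<in>-T. \<bar>\<Sum>j\<in>S. A $ i $ j\<bar>)"
    unfolding ind by (subst sum.union_disjoint[of T "-T", simplified]) auto
  also have "\<dots> = flow A T S"
    unfolding flow_def
  proof (intro arg_cong2[of _ _ _ _ "(+)"] sum.cong refl)
    fix i
    show "\<bar>(\<Sum>j\<in>S. A $ i $ j) - 1\<bar> = (\<Sum>j\<in>-S. A $ i $ j)"
      using row[of i] nonneg[of i "-S"] by linarith
    show "\<bar>\<Sum>j\<in>S. A $ i $ j\<bar> = (\<Sum>j\<in>S. A $ i $ j)"
      using nonneg[of i S] by simp
  qed
  finally show ?thesis ..
qed

text \<open>
  The rows in \<open>T\<close> and the columns in \<open>S\<close> carry the same total mass \<open>card T = card S\<close>. They share the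
  block \<open>T \<times> S\<close>, so the masses of the remaining blocks \<open>T \<times> -S\<close> and \<open>-T \<times> S\<close> agree.
\<close>

lemma flow_eq_twice_outflow:
  fixes A :: "real^'n^'n"
  assumes "doubly_stochastic A" and "card S = card T"
  shows "flow A T S = 2 * (\<Sum>i\<in>T. \<Sum>j\<in>-S. A $ i $ j)"
proof -
  have rows: "(\<Sum>j\<in>S. A $ i $ j) + (\<Sum>j\<in>-S. A $ i $ j) = 1" for i
    using doubly_stochastic_row[OF assms(1), of i]
      sum.union_disjoint[of S "-S" "\<lambda>j. A $ i $ j"] by simp
  have columns: "(\<Sum>i\<in>T. A $ i $ j) + (\<Sum>i\<in>-T. A $ i $ j) = 1" for j
    using doubly_stochastic_column[OF assms(1), of j]
      sum.union_disjoint[of T "-T" "\<lambda>i. A $ i $ j"] by simp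
  have "(\<Sum>i\<in>T. \<Sum>j\<in>S. A $ i $ j) + (\<Sum>i\<in>T. \<Sum>j\<in>-S. A $ i $ j) = card T"
    by (simp add: sum.distrib[symmetric] rows)
  moreover have "(\<Sum>j\<in>S. \<Sum>i\<in>T. A $ i $ j) + (\<Sum>j\<in>S. \<Sum>i\<in>-T. A $ i $ j) = card S"
    by (simp add: sum.distrib[symmetric] columns)
  ultimately show ?thesis
    using assms(2) sum.swap[of "\<lambda>i j. A $ i $ j" S T] sum.swap[of "\<lambda>i j. A $ i $ j" S "-T"]
    by (simp add: flow_def)
qed

section \<open>Infinite walks obstruct ergodicity\<close>

text \<open>
  The new error is the image of the old one under \<open>A k\<close>, which has not grown in \<open>\<ell>\<^sup>1\<close> norm, plus the
  error of moving the indicator of \<open>S k\<close> to that of \<open>S (Suc k)\<close>, which is a flow.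
\<close>

lemma chain_tracks_walk:
  fixes A :: "nat \<Rightarrow> real^'n^'n"
  assumes ds: "\<And>k. doubly_stochastic (A k)"
  shows "(\<Sum>i\<in>UNIV. \<bar>(chain_prod A k 0 *v (\<chi> j. indicator (S 0) j)) $ i - indicator (S k) i\<bar>)
    \<le> (\<Sum>l<k. flow (A l) (S (Suc l)) (S l))"
proof (induction k)
  case 0
  then show ?case by simp
next
  case (Suc k)
  let ?u = "\<lambda>k. (\<chi> j. indicator (S k) j) :: real^'n"
  let ?x = "\<lambda>k. chain_prod A k 0 *v ?u 0"
  have step: "?x (Suc k) $ i - ?u (Suc k) $ i =
      (A k *v (?x k - ?u k)) $ i + ((A k *v ?u k) $ i - ?u (Suc k) $ i)" for i
    by (simp add: matrix_vector_mul_assoc matrix_vector_mult_diff_distrib)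
  have "(\<Sum>i\<in>UNIV. \<bar>?x (Suc k) $ i - ?u (Suc k) $ i\<bar>)
      \<le> (\<Sum>i\<in>UNIV. \<bar>(A k *v (?x k - ?u k)) $ i\<bar>)
        + (\<Sum>i\<in>UNIV. \<bar>(A k *v ?u k) $ i - ?u (Suc k) $ i\<bar>)"
    unfolding step sum.distrib[symmetric] by (intro sum_mono abs_triangle_ineq)
  also have "\<dots> \<le> (\<Sum>i\<in>UNIV. \<bar>(?x k - ?u k) $ i\<bar>) + flow (A k) (S (Suc k)) (S k)"
    using doubly_stochastic_l1_nonexpansive[OF ds, of k "?x k - ?u k"]
    by (simp add: flow_eq_l1_distance[OF ds])
  also have "\<dots> \<le> (\<Sum>l<Suc k. flow (A l) (S (Suc l)) (S l))"
    using Suc.IH by simp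
  finally show ?case by simp
qed

lemma small_flow_from_zero_infimum:
  assumes "(INF A\<in>M. ereal (flow A T S)) = 0" and "0 < \<epsilon>"
  shows "\<exists>A\<in>M. flow A T S < \<epsilon>"
proof -
  have "(INF A\<in>M. ereal (flow A T S)) < ereal \<epsilon>"
    using assms by simp
  then show ?thesis
    by (auto simp: INF_less_iff)
qed

lemma not_stable_if_infinite_walk:
  fixes M :: "(real^'n^'n) set"
  assumes ds: "\<And>A. A \<in> M \<Longrightarrow> doubly_stochastic A"
    and walk: "\<And>k. (S k, S (Suc k)) \<in> parcs (zero_flow_graph M)"
  shows "\<not> absolutely_asymptotically_stable M"
proof
  assume stable: "absolutely_asymptotically_stable M"
  \<comment> \<open>The bounds sum to \<open>1/4\<close>: if all entries are within \<open>1/4\<close> of zero or one, and both values occur,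
    then the spread of the entries is at least \<open>1/2\<close>.\<close>
  have "\<exists>A\<in>M. flow A (S (Suc k)) (S k) < (1/2)^(k+3)" for k
    using walk[of k] by (intro small_flow_from_zero_infimum) (auto simp: zero_flow_graph_def)
  then obtain A where A: "\<And>k. A k \<in> M"
      and small: "\<And>k. flow (A k) (S (Suc k)) (S k) < (1/2)^(k+3)"
    by metis
  have "ergodic A"
    using stable A by (auto simp: absolutely_asymptotically_stable_def)
  then obtain v where v: "(\<lambda>k. chain_prod A k 0) \<longlonglongrightarrow> (\<chi> i j. v $ j)"
    by (auto simp: ergodic_def)
  define x where "x k = chain_prod A k 0 *v (\<chi> j. indicator (S 0) j)" for k
  define c where "c = (\<Sum>j\<in>UNIV. v $ j * indicator (S 0) j)"
  have "(\<lambda>k. x k $ i) \<longlonglongrightarrow> c" for i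
  proof -
    have "(\<lambda>k. chain_prod A k 0 $ i $ j) \<longlonglongrightarrow> v $ j" for j
      using tendsto_vec_nth[OF tendsto_vec_nth[OF v]] by simp
    then have "(\<lambda>k. \<Sum>j\<in>UNIV. chain_prod A k 0 $ i $ j * indicator (S 0) j) \<longlonglongrightarrow> c"
      unfolding c_def by (intro tendsto_sum tendsto_mult_right)
    then show ?thesis
      by (simp add: x_def matrix_vector_mult_def)
  qed
  then have "\<forall>\<^sub>F k in sequentially. \<bar>x k $ i - c\<bar> < 1/4" for i
    using tendstoD[where e = "1/4"] by (fastforce simp: dist_real_def)
  then have "\<forall>\<^sub>F k in sequentially. \<forall>i\<in>UNIV. \<bar>x k $ i - c\<bar> < 1/4"
    by (intro eventually_ball_finite) auto
  then obtain k where near_c: "\<And>i. \<bar>x k $ i - c\<bar> < 1/4"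
    by (auto simp: eventually_sequentially)
  have near_S: "\<bar>x k $ i - indicator (S k) i\<bar> \<le> 1/4" for i
  proof -
    have "\<bar>x k $ i - indicator (S k) i\<bar> \<le> (\<Sum>i\<in>UNIV. \<bar>x k $ i - indicator (S k) i\<bar>)"
      by (rule member_le_sum) auto
    also have "\<dots> \<le> (\<Sum>l<k. flow (A l) (S (Suc l)) (S l))"
      unfolding x_def by (rule chain_tracks_walk) (simp add: ds A)
    also have "\<dots> \<le> (\<Sum>l<k. (1/2)^(l+3))"
      by (intro sum_mono less_imp_le small)
    also have "\<dots> = (1 - (1/2)^k) / 4"
      by (induction k) (simp_all add: power_add field_simps)
    also have "\<dots> \<le> 1/4"
      by simp
    finally show ?thesis .
  qed
  have "S k \<noteq> UNIV" "card (S k) \<noteq> 0"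
    using walk[of k] by (simp_all add: zero_flow_graph_def)
  then obtain i j where "i \<in> S k" "j \<notin> S k"
    by fastforce
  then show False
    using near_S[of i] near_S[of j] near_c[of i] near_c[of j] by (auto simp: abs_if split: if_splits)
qed

section \<open>Sums of the largest entries\<close>

definition largest_sum :: "real^'n \<Rightarrow> nat \<Rightarrow> real" where
  "largest_sum x p = Max ((\<lambda>S. \<Sum>i\<in>S. x $ i) ` {S. card S = p})"

lemma sum_le_largest_sum: "(\<Sum>i\<in>S. x $ i) \<le> largest_sum x (card S)"
  unfolding largest_sum_def by (rule Max_ge) auto

lemma largest_sum_attained:
  fixes x :: "real^'n"
  assumes "p \<le> CARD('n)"
  obtains S where "card S = p" and "(\<Sum>i\<in>S. x $ i) = largest_sum x p"
proof -
  obtain S0 :: "'n set" where "card S0 = p"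
    using obtain_subset_with_card_n[OF assms] by blast
  then have "largest_sum x p \<in> (\<lambda>S. \<Sum>i\<in>S. x $ i) ` {S. card S = p}"
    unfolding largest_sum_def by (intro Max_in) auto
  then show thesis
    using that by auto
qed

lemma largest_sum_0 [simp]: "largest_sum x 0 = 0"
proof -
  obtain S where "card S = 0" "(\<Sum>i\<in>S. x $ i) = largest_sum x 0"
    using largest_sum_attained[of 0 x] by auto
  then show ?thesis by simp
qed

lemma largest_sum_all: "largest_sum x CARD('n) = (\<Sum>i\<in>UNIV. x $ i)" for x :: "real^'n"
proof -
  obtain S :: "'n set" where "card S = CARD('n)" "(\<Sum>i\<in>S. x $ i) = largest_sum x CARD('n)"
    using largest_sum_attained[of "CARD('n)" x] by auto
  moreover from this have "S = UNIV"
    by (metis card_subset_eq finite subset_UNIV)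
  ultimately show ?thesis by simp
qed

text \<open>
  Moving one element from the larger of two optimal sets to the smaller one gives two sets of size
  \<open>p\<close> with the same total.
\<close>

lemma largest_sum_concave:
  fixes x :: "real^'n"
  assumes "0 < p" and "p < CARD('n)"
  shows "largest_sum x (p - 1) + largest_sum x (p + 1) \<le> 2 * largest_sum x p"
proof -
  have bounds: "p - 1 \<le> CARD('n)" "p + 1 \<le> CARD('n)"
    using assms by auto
  obtain S where S: "card S = p - 1" "(\<Sum>i\<in>S. x $ i) = largest_sum x (p - 1)"
    using largest_sum_attained[OF bounds(1)] .
  obtain T where T: "card T = p + 1" "(\<Sum>i\<in>T. x $ i) = largest_sum x (p + 1)"
    using largest_sum_attained[OF bounds(2)] .
  obtain t where t: "t \<in> T" "t \<notin> S"
    using S T card_mono[of S T] by force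
  have "card (insert t S) = p" "card (T - {t}) = p"
    using S T t assms by auto
  then show ?thesis
    using sum_le_largest_sum[of x "insert t S"] sum_le_largest_sum[of x "T - {t}"] S T t
    by (simp add: sum_diff1)
qed

text \<open>
  Write the sum of \<open>A x\<close> over \<open>T\<close> as \<open>\<Sum>\<^sub>j c\<^sub>j x\<^sub>j\<close> with \<open>0 \<le> c\<^sub>j \<le> 1\<close> and \<open>\<Sum>\<^sub>j c\<^sub>j = p\<close>. Compared with the
  sum of \<open>x\<close> over \<open>S\<close>, weight \<open>flow A T S / 2\<close> has moved out of \<open>S\<close>, and each unit of it costs at least
  the gap between the entries inside and outside \<open>S\<close>.
\<close>

lemma largest_sum_decrease:
  fixes A :: "real^'n^'n"
  assumes ds: "doubly_stochastic A" and p: "0 < p"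
    and S: "card S = p" "(\<Sum>j\<in>S. x $ j) = largest_sum x p"
    and T: "card T = p" "(\<Sum>i\<in>T. (A *v x) $ i) = largest_sum (A *v x) p"
  shows "(2 * largest_sum x p - largest_sum x (p - 1) - largest_sum x (p + 1)) * (flow A T S / 2)
    \<le> largest_sum x p - largest_sum (A *v x) p"
proof -
  define a where "a = largest_sum x p - largest_sum x (p - 1)"
  define b where "b = largest_sum x (p + 1) - largest_sum x p"
  define c where "c j = (\<Sum>i\<in>T. A $ i $ j)" for j
  \<comment> \<open>Comparing with the optimal sums of sizes \<open>p - 1\<close> and \<open>p + 1\<close> separates the entries inside and
    outside \<open>S\<close> without sorting \<open>x\<close>.\<close>
  have x_in: "a \<le> x $ j" if "j \<in> S" for j
    using sum_le_largest_sum[of x "S - {j}"] S that by (simp add: a_def sum_diff1)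
  have x_out: "x $ j \<le> b" if "j \<notin> S" for j
    using sum_le_largest_sum[of x "insert j S"] S that by (simp add: b_def)
  have c_nonneg: "0 \<le> c j" for j
    by (simp add: c_def sum_nonneg doubly_stochastic_nonneg[OF ds])
  have c_le: "c j \<le> 1" for j
    using sum_mono2[of UNIV T "\<lambda>i. A $ i $ j"]
    by (simp add: c_def doubly_stochastic_nonneg[OF ds] doubly_stochastic_column[OF ds])
  have split: "(\<Sum>j\<in>S. h j) + (\<Sum>j\<in>-S. h j) = (\<Sum>j\<in>UNIV. h j)" for h :: "'n \<Rightarrow> real"
    using sum.union_disjoint[of S "-S" h] by simp
  have out: "(\<Sum>j\<in>-S. c j) = flow A T S / 2"
    using flow_eq_twice_outflow[OF ds, of S T] S T sum.swap[of "\<lambda>i j. A $ i $ j" "-S" T]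
    by (simp add: c_def)
  have "(\<Sum>j\<in>UNIV. c j) = p"
    unfolding c_def using T by (subst sum.swap) (simp add: doubly_stochastic_row[OF ds])
  then have "in": "(\<Sum>j\<in>S. 1 - c j) = flow A T S / 2"
    using split[of c] out S by (simp add: sum_subtractf)
  have y: "largest_sum (A *v x) p = (\<Sum>j\<in>UNIV. c j * x $ j)"
    unfolding T(2)[symmetric]
    by (simp add: c_def matrix_vector_mult_def sum_distrib_right) (rule sum.swap)
  have "(a - b) * (flow A T S / 2) = (\<Sum>j\<in>S. (1 - c j) * a) - (\<Sum>j\<in>-S. c j * b)"
    unfolding sum_distrib_right[symmetric] "in" out by (simp add: field_simps)
  also have "\<dots> \<le> (\<Sum>j\<in>S. (1 - c j) * x $ j) - (\<Sum>j\<in>-S. c j * x $ j)"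
    using x_in x_out c_nonneg c_le
    by (intro diff_mono sum_mono mult_left_mono) auto
  also have "\<dots> = largest_sum x p - largest_sum (A *v x) p"
    using split[of "\<lambda>j. c j * x $ j"] S(2) unfolding y
    by (simp add: left_diff_distrib sum_subtractf)
  finally show ?thesis
    by (simp add: a_def b_def algebra_simps)
qed

lemma largest_sum_mult_le:
  fixes A :: "real^'n^'n"
  assumes ds: "doubly_stochastic A" and p: "p \<le> CARD('n)"
  shows "largest_sum (A *v x) p \<le> largest_sum x p"
proof -
  consider "p = 0" | "p = CARD('n)" | "0 < p" "p < CARD('n)"
    using p by linarith
  then show ?thesis
  proof cases
    case 3
    obtain S where S: "card S = p" "(\<Sum>i\<in>S. x $ i) = largest_sum x p"
      using largest_sum_attained[OF p] .
    obtain T where T: "card T = p" "(\<Sum>i\<in>T. (A *v x) $ i) = largest_sum (A *v x) p"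
      using largest_sum_attained[OF p] .
    have "0 \<le> (2 * largest_sum x p - largest_sum x (p - 1) - largest_sum x (p + 1))
        * (flow A T S / 2)"
      using largest_sum_concave[OF 3, of x] flow_nonneg[OF ds] by (intro mult_nonneg_nonneg) auto
    then show ?thesis
      using largest_sum_decrease[OF ds 3(1) S T] by linarith
  qed (simp_all add: largest_sum_all doubly_stochastic_sum_preserved[OF ds])
qed

section \<open>Averaging in the absence of infinite walks\<close>

lemma largest_sum_convergent:
  fixes x :: "nat \<Rightarrow> real^'n"
  assumes ds: "\<And>k. doubly_stochastic (A k)"
    and step: "\<And>k. x (Suc k) = A k *v x k"
    and p: "p \<le> CARD('n)"
  shows "convergent (\<lambda>k. largest_sum (x k) p)"
proof -
  have dec: "decseq (\<lambda>k. largest_sum (x k) p)"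
    by (rule decseq_SucI) (simp add: step largest_sum_mult_le[OF ds p])
  have l1: "(\<Sum>i\<in>UNIV. \<bar>x k $ i\<bar>) \<le> (\<Sum>i\<in>UNIV. \<bar>x 0 $ i\<bar>)" for k
    by (induction k)
       (auto simp: step intro: order_trans[OF doubly_stochastic_l1_nonexpansive[OF ds]])
  obtain S :: "'n set" where S: "card S = p"
    using obtain_subset_with_card_n[OF p] by blast
  have "- (\<Sum>i\<in>UNIV. \<bar>x 0 $ i\<bar>) \<le> largest_sum (x k) p" for k
  proof -
    have "\<bar>\<Sum>i\<in>S. x k $ i\<bar> \<le> (\<Sum>i\<in>S. \<bar>x k $ i\<bar>)"
      by (rule sum_abs)
    also have "\<dots> \<le> (\<Sum>i\<in>UNIV. \<bar>x k $ i\<bar>)"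
      by (rule sum_mono2) auto
    finally show ?thesis
      using l1[of k] sum_le_largest_sum[of "x k" S] S by simp
  qed
  then obtain L where "(\<lambda>k. largest_sum (x k) p) \<longlonglongrightarrow> L"
    using decseq_convergent[OF dec] by blast
  then show ?thesis
    by (rule convergentI)
qed

text \<open>
  If the gap at \<open>p\<close> had a positive limit, then \<open>largest_sum_decrease\<close> would force the flows between
  successive sets of \<open>p\<close> largest positions to zero. A pair with positive infimum could then occur
  only finitely often, and from some time on these sets would form a walk.
\<close>

lemma limit_gap_zero:
  fixes x :: "nat \<Rightarrow> real^'n" and M :: "(real^'n^'n) set"
  assumes ds: "\<And>A. A \<in> M \<Longrightarrow> doubly_stochastic A" and A: "\<And>k. A k \<in> M"
    and step: "\<And>k. x (Suc k) = A k *v x k"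
    and no_walk: "\<not> (\<exists>S. \<forall>k. (S k, S (Suc k)) \<in> parcs (zero_flow_graph M))"
    and F: "\<And>q. q \<le> CARD('n) \<Longrightarrow> (\<lambda>k. largest_sum (x k) q) \<longlonglongrightarrow> F q"
    and p: "0 < p" "p < CARD('n)"
  shows "2 * F p = F (p - 1) + F (p + 1)"
proof (rule ccontr)
  define gap where
    "gap k = 2 * largest_sum (x k) p - largest_sum (x k) (p - 1) - largest_sum (x k) (p + 1)" for k
  assume neq: "2 * F p \<noteq> F (p - 1) + F (p + 1)"
  have gap_lim: "gap \<longlonglongrightarrow> 2 * F p - F (p - 1) - F (p + 1)" (is "_ \<longlonglongrightarrow> ?G")
    unfolding gap_def using p by (intro tendsto_intros F) auto
  have "0 \<le> ?G"
    using largest_sum_concave[OF p]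
    by (intro tendsto_lowerbound[OF gap_lim] always_eventually)
       (simp_all add: gap_def le_diff_eq add.commute)
  with neq have G_pos: "0 < ?G" by linarith
  have "\<exists>S. card S = p \<and> (\<Sum>i\<in>S. x k $ i) = largest_sum (x k) p" for k
    by (rule largest_sum_attained[of p "x k"]) (use p in auto)
  then obtain S where card_S: "\<And>k. card (S k) = p"
      and S: "\<And>k. (\<Sum>i\<in>S k. x k $ i) = largest_sum (x k) p"
    by metis
  define fl where "fl k = flow (A k) (S (Suc k)) (S k)" for k
  have decrease: "gap k * (fl k / 2) \<le> largest_sum (x k) p - largest_sum (x (Suc k)) p" for k
    using S[of "Suc k"]
      largest_sum_decrease[OF ds[OF A[of k]] p(1) card_S[of k] S[of k] card_S[of "Suc k"]]
    by (simp add: gap_def fl_def step)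
  have decrease_lim: "(\<lambda>k. largest_sum (x k) p - largest_sum (x (Suc k)) p) \<longlonglongrightarrow> F p - F p"
    using F[of p] p by (intro tendsto_diff LIMSEQ_Suc) auto
  have gap_pos: "\<forall>\<^sub>F k in sequentially. 0 < gap k"
    using order_tendstoD(1)[OF gap_lim G_pos] .
  have "fl \<longlonglongrightarrow> 0"
  proof (rule tendsto_sandwich)
    show "\<forall>\<^sub>F k in sequentially. 0 \<le> fl k"
      by (simp add: fl_def flow_nonneg ds A)
    show "\<forall>\<^sub>F k in sequentially.
        fl k \<le> 2 * (largest_sum (x k) p - largest_sum (x (Suc k)) p) / gap k"
      using gap_pos
    proof eventually_elim
      case (elim k)
      then show ?case
        using decrease[of k] by (simp add: field_simps)
    qed
    show "(\<lambda>k. 2 * (largest_sum (x k) p - largest_sum (x (Suc k)) p) / gap k) \<longlonglongrightarrow> 0"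
      using tendsto_divide[OF tendsto_mult[OF tendsto_const[of 2] decrease_lim] gap_lim] G_pos
      by simp
  qed simp
  \<comment> \<open>A non-edge of sets of the right size has flow at least some \<open>\<epsilon> > 0\<close> throughout \<open>M\<close>.\<close>
  have avoid: "\<forall>\<^sub>F k in sequentially. (S k, S (Suc k)) \<noteq> e"
    if e: "e \<notin> parcs (zero_flow_graph M)" for e
  proof (rule ccontr)
    obtain U V where UV: "e = (U, V)" by (cases e)
    assume not_avoid: "\<not> ?thesis"
    then obtain k where "S k = U" "S (Suc k) = V"
      using UV not_eventuallyD[OF not_avoid] frequently_ex by fastforce
    with card_S have card: "card U = p" "card V = p" by auto
    then have "U \<noteq> UNIV" "V \<noteq> UNIV" using p by auto
    then have "(INF B\<in>M. ereal (flow B V U)) \<noteq> 0"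
      using e p card UV by (auto simp: zero_flow_graph_def)
    moreover have "0 \<le> (INF B\<in>M. ereal (flow B V U))"
      by (intro INF_greatest) (simp add: flow_nonneg ds)
    ultimately have "0 < (INF B\<in>M. ereal (flow B V U))"
      by simp
    then obtain \<epsilon> where \<epsilon>: "0 < ereal \<epsilon>" "ereal \<epsilon> < (INF B\<in>M. ereal (flow B V U))"
      using ereal_dense2 by blast
    have large: "\<epsilon> < flow B V U" if "B \<in> M" for B
      using less_le_trans[OF \<epsilon>(2) INF_lower[OF that]] by simp
    have "\<forall>\<^sub>F k in sequentially. fl k < \<epsilon>"
      using order_tendstoD(2)[OF \<open>fl \<longlonglongrightarrow> 0\<close>] \<epsilon>(1) by simp
    then have "\<forall>\<^sub>F k in sequentially. (S k, S (Suc k)) \<noteq> e"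
    proof eventually_elim
      case (elim k)
      then show ?case
        using large[OF A, of k] UV by (auto simp: fl_def)
    qed
    with not_avoid show False ..
  qed
  have "\<forall>\<^sub>F k in sequentially. \<forall>e\<in>- parcs (zero_flow_graph M). (S k, S (Suc k)) \<noteq> e"
    using avoid by (intro eventually_ball_finite) auto
  then obtain K where "\<And>k. k \<ge> K \<Longrightarrow> (S k, S (Suc k)) \<in> parcs (zero_flow_graph M)"
    by (auto simp: eventually_sequentially)
  then have "\<forall>k. (S (K + k), S (K + Suc k)) \<in> parcs (zero_flow_graph M)"
    by simp
  with no_walk show False
    by (auto dest!: spec[of _ "\<lambda>k. S (K + k)"])
qed

text \<open>
  Vanishing second differences make the limits \<open>F p\<close> affine in \<open>p\<close>. Since \<open>F 0 = 0\<close> and \<open>F m\<close> is the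
  total sum, the limit \<open>F 1\<close> of the largest entry is the average. With the sum fixed, no entry can then
  stay below the average.
\<close>

lemma tends_to_average:
  fixes x :: "nat \<Rightarrow> real^'n" and M :: "(real^'n^'n) set"
  assumes ds: "\<And>A. A \<in> M \<Longrightarrow> doubly_stochastic A" and A: "\<And>k. A k \<in> M"
    and step: "\<And>k. x (Suc k) = A k *v x k"
    and no_walk: "\<not> (\<exists>S. \<forall>k. (S k, S (Suc k)) \<in> parcs (zero_flow_graph M))"
  shows "(\<lambda>k. x k $ i) \<longlonglongrightarrow> (\<Sum>j\<in>UNIV. x 0 $ j) / CARD('n)"
proof -
  define \<sigma> where "\<sigma> = (\<Sum>j\<in>UNIV. x 0 $ j)"
  have sum_x: "(\<Sum>j\<in>UNIV. x k $ j) = \<sigma>" for k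
    by (induction k) (simp_all add: \<sigma>_def step doubly_stochastic_sum_preserved ds A)
  define F where "F q = lim (\<lambda>k. largest_sum (x k) q)" for q
  have F: "(\<lambda>k. largest_sum (x k) q) \<longlonglongrightarrow> F q" if "q \<le> CARD('n)" for q
    using largest_sum_convergent[of A x q] ds A step that
    by (simp add: F_def convergent_LIMSEQ_iff)
  have F0: "F 0 = 0"
    using F[of 0] by (simp add: LIMSEQ_const_iff)
  have "F p = p * F 1 \<and> F (p + 1) = (p + 1) * F 1" if "p + 1 \<le> CARD('n)" for p
    using that
  proof (induction p)
    case 0
    then show ?case by (simp add: F0)
  next
    case (Suc p)
    then show ?case
      using limit_gap_zero[OF ds A step no_walk F, of "Suc p"] by (simp add: algebra_simps)
  qed
  from this[of "CARD('n) - 1"] have "F CARD('n) = CARD('n) * F 1"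
    by simp
  moreover have "F CARD('n) = \<sigma>"
    using F[of "CARD('n)"] by (simp add: largest_sum_all sum_x LIMSEQ_const_iff)
  ultimately have F1: "F 1 = \<sigma> / CARD('n)"
    by simp
  have max_lim: "(\<lambda>k. largest_sum (x k) 1) \<longlonglongrightarrow> \<sigma> / CARD('n)"
    using F[of 1] F1 by simp
  have le_max: "x k $ j \<le> largest_sum (x k) 1" for k j
    using sum_le_largest_sum[of "x k" "{j}"] by simp
  \<comment> \<open>The other \<open>m - 1\<close> entries are at most the maximum.\<close>
  have ge: "\<sigma> - (CARD('n) - 1) * largest_sum (x k) 1 \<le> x k $ i" for k
  proof -
    have "\<sigma> - x k $ i = (\<Sum>j\<in>UNIV - {i}. x k $ j)"
      by (simp add: sum_diff1 sum_x)
    also have "\<dots> \<le> (CARD('n) - 1) * largest_sum (x k) 1"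
      using sum_bounded_above[of "UNIV - {i}" "\<lambda>j. x k $ j" "largest_sum (x k) 1"] le_max
      by (simp add: of_nat_diff)
    finally show ?thesis by simp
  qed
  have "(\<lambda>k. x k $ i) \<longlonglongrightarrow> \<sigma> / CARD('n)"
  proof (rule tendsto_sandwich)
    show "\<forall>\<^sub>F k in sequentially. \<sigma> - (CARD('n) - 1) * largest_sum (x k) 1 \<le> x k $ i"
      using ge by simp
    show "\<forall>\<^sub>F k in sequentially. x k $ i \<le> largest_sum (x k) 1"
      using le_max by simp
    have "(\<lambda>k. \<sigma> - (CARD('n) - 1) * largest_sum (x k) 1)
        \<longlonglongrightarrow> \<sigma> - (CARD('n) - 1) * (\<sigma> / CARD('n))"
      by (intro tendsto_intros max_lim)
    moreover have "\<sigma> - (CARD('n) - 1) * (\<sigma> / CARD('n)) = \<sigma> / CARD('n)"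
      by (simp add: field_simps of_nat_diff)
    ultimately show "(\<lambda>k. \<sigma> - (CARD('n) - 1) * largest_sum (x k) 1) \<longlonglongrightarrow> \<sigma> / CARD('n)"
      by simp
  qed (rule max_lim)
  then show ?thesis
    by (simp add: \<sigma>_def)
qed

lemma stable_if_no_infinite_walk:
  fixes M :: "(real^'n^'n) set"
  assumes ds: "\<And>A. A \<in> M \<Longrightarrow> doubly_stochastic A"
    and no_walk: "\<not> (\<exists>S. \<forall>k. (S k, S (Suc k)) \<in> parcs (zero_flow_graph M))"
  shows "absolutely_asymptotically_stable M"
  unfolding absolutely_asymptotically_stable_def ergodic_def
proof (intro allI impI conjI exI)
  fix A :: "nat \<Rightarrow> real^'n^'n" and s
  assume A: "\<forall>k. A k \<in> M"
  show "stochastic (A k)" for k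
    using ds A by (auto simp: doubly_stochastic_def)
  let ?v = "(\<chi> j. 1 / CARD('n)) :: real^'n"
  show "stochastic_vector ?v"
    by (simp add: stochastic_vector_def)
  have "(\<lambda>k. chain_prod A (k + s) s $ i $ j) \<longlonglongrightarrow> ?v $ j" for i j
  proof -
    define x where "x k = chain_prod A (k + s) s *v axis j 1" for k
    have "chain_prod A s s = mat 1"
      by (cases s) auto
    then have x0: "x 0 = axis j 1"
      by (simp add: x_def)
    have "x (Suc k) = A (k + s) *v x k" for k
      by (simp add: x_def matrix_vector_mul_assoc)
    then have "(\<lambda>k. x k $ i) \<longlonglongrightarrow> (\<Sum>l\<in>UNIV. x 0 $ l) / CARD('n)"
      using A by (intro tends_to_average[OF ds _ _ no_walk]) auto
    moreover have "(\<Sum>l\<in>UNIV. x 0 $ l) = 1"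
      by (simp add: x0 axis_def)
    moreover have "x k $ i = chain_prod A (k + s) s $ i $ j" for k
      by (simp add: x_def matrix_vector_mult_basis column_def)
    ultimately show ?thesis by simp
  qed
  then have "(\<lambda>k. chain_prod A (k + s) s) \<longlonglongrightarrow> (\<chi> i j. ?v $ j)"
    by (intro vec_tendstoI) simp
  then show "(\<lambda>k. chain_prod A k s) \<longlonglongrightarrow> (\<chi> i j. ?v $ j)"
    by (rule LIMSEQ_offset)
qed

theorem theorem10:
  fixes M :: "(real^'n^'n) set"
  assumes "\<And>A. A \<in> M \<Longrightarrow> doubly_stochastic A"
  shows "absolutely_asymptotically_stable M \<longleftrightarrow> cycle_free (with_proj (zero_flow_graph M))"
proof -
  have "cycle_free (with_proj (zero_flow_graph M)) \<longleftrightarrow>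
      \<not> (\<exists>S. \<forall>k. (S k, S (Suc k)) \<in> parcs (zero_flow_graph M))"
    by (rule cycle_free_iff_no_infinite_walk) (simp add: zero_flow_graph_def)
  then show ?thesis
    using not_stable_if_infinite_walk[OF assms] stable_if_no_infinite_walk[OF assms] by blast
qed

end
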